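(* Let $n\ge 1$ and let $c=(c_0,\dots,c_{n-1})$ be positive speeds with $1=c_0\ge c_1\ge\dots\ge c_{n-1}$. Then $\mathcal{P}\text{-MSP}_n(c)$ admits a solution with search cost $$\min_{i=1,\ldots,n } \frac{\mathcal{U}_i }{ \mathcal{G}_i}.$$ In particular, this upper bound is achieved by utilizing only the agents $\{0,1,\dots,\ell\}$ to expose targets, where $\ell\in\{0,\dots,n-1\}$ is the largest index satisfying $$c_\ell \geq \left(\frac{\mathcal{U}_{\ell+1}}{\mathcal{U}_{\ell}}\right)^{\ell+1}\mathcal{G}_\ell .$$
   Context: For a positive integer $i$, $\kappa_i$ is the unique positive root of $k^3+k=\frac{i}{2\pi}$ and $\mathcal U_i=\frac{\sqrt{1+\kappa_i^2}}{\kappa_i}e^{2\pi\kappa_i/i}$. $\mathcal G_l=\left(\prod_{i=0}^{l-1}c_i\right)^{1/l}$ is the geometric mean of the speeds of agents $0,\dots,l-1$. Conventions: $\mathcal G_0=1$ and $\mathcal U_0=+\infty$ (so the condition on $\ell$ holds for $\ell=0$). Polar notation: $\langle \rho,\chi\rangle = \rho(\cos\chi,\sin\chi)$. A point $P=\langle x,\psi\rangle$ exposes $A=\langle y,\psi\rangle$ (with $x,y>0$, same ray from the origin) if $x\ge y$. $[n]=\{0,\dots,n-1\}$. $\mathcal P=\mathbb R^2\setminus\{(0,0)\}$. Problem $\mathcal D\text{-MSP}_n(c)$, for a search domain $\mathcal D\subseteq\mathbb R^2\setminus\{(0,0)\}$ and speeds $c=(c_0,\dots,c_{n-1})$: a feasible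 solution consists of continuous, piecewise differentiable curves $\tau_i:\mathbb R\to\mathbb R^2$, $i\in[n]$, with $\lim_{t\to-\infty}\tau_i(t)=(0,0)$, such that every $A\in\mathcal D$ is exposed by some point $\tau_i(t)$ of some curve. The parameter $t$ is not physical time: agent $i$ moves along $\tau_i$ at speed $c_i$, so it reaches $\tau_i(t)$ at time $\ell_i(t)/c_i$, where $\ell_i(t)=\int_{-\infty}^t\|\tau_i'(u)\|\,du$. If $t_A^i$ is the earliest parameter at which $\tau_i(t_A^i)$ exposes $A$ (infinite if none), the search cost of the solution is $\sup_{A\in\mathcal D}\frac1{\|A\|}\min_{i\in[n]}\frac{\ell_i(t_A^i)}{c_i}$. "Admits a solution with search cost $S$" means there is a feasible solution whose search cost equals $S$. "Utilizing only the agents in a set $B$" means that no agents outside $B$ are used: the trajectories of the agents in $B$ alone already expose every target and attain the stated search cost (the remaining agents are ignored). *)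

theory Defs
  imports "HOL-Analysis.Analysis"
begin

type_synonym point = "real \<times> real"

definition polar :: "real \<Rightarrow> real \<Rightarrow> point" where
  "polar \<rho> \<psi> = \<rho> *\<^sub>R (cos \<psi>, sin \<psi>)"

definition exposes :: "point \<Rightarrow> point \<Rightarrow> bool" where
  "exposes P A \<longleftrightarrow>
     (\<exists>x y \<psi>. 0 < x \<and> 0 < y \<and> P = polar x \<psi> \<and> A = polar y \<psi> \<and> y \<le> x)"

definition punctured_plane :: "point set" where
  "punctured_plane = UNIV - {(0, 0)}"

text \<open>A curve defined on the whole line may have infinitely many break points, as long as only
  finitely many of them lie in each compact interval. The predicate
  \<^const>\<open>piecewise_differentiable_on\<close> includes continuity.\<close>

definition trajectory :: "(real \<Rightarrow> point) \<Rightarrow> bool" where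
  "trajectory \<tau> \<longleftrightarrow>
     (\<forall>a b. \<tau> piecewise_differentiable_on {a..b}) \<and> (\<tau> \<longlongrightarrow> (0, 0)) at_bot"

text \<open>Path length may be infinite. The value of the derivative at the break points, which form a
  null set, is irrelevant.\<close>

definition traj_length :: "(real \<Rightarrow> point) \<Rightarrow> real \<Rightarrow> ennreal" where
  "traj_length \<tau> t =
     (\<integral>\<^sup>+ u\<in>{..t}. ennreal (norm (vector_derivative \<tau> (at u))) \<partial>lborel)"

text \<open>For a trajectory, the set of parameters exposing a fixed point is closed and bounded
  below, so when it is nonempty its infimum is the earliest exposing parameter. An agent that never
  exposes the point gets infinite time, even if its whole trajectory has finite length.\<close>

definition exposure_time :: "real \<Rightarrow> (real \<Rightarrow> point) \<Rightarrow> point \<Rightarrow> ennreal" where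
  "exposure_time s \<tau> A =
     (if \<exists>t. exposes (\<tau> t) A
      then traj_length \<tau> (Inf {t. exposes (\<tau> t) A}) / ennreal s
      else \<infinity>)"

text \<open>In the next two definitions \<open>B\<close> is the set of agents in use; the problem with
  \<open>n\<close> agents is the case \<open>B = {..<n}\<close>.\<close>

definition msp_feasible :: "point set \<Rightarrow> nat set \<Rightarrow> (nat \<Rightarrow> real \<Rightarrow> point) \<Rightarrow> bool" where
  "msp_feasible D B \<tau> \<longleftrightarrow>
     (\<forall>i\<in>B. trajectory (\<tau> i)) \<and> (\<forall>A\<in>D. \<exists>i\<in>B. \<exists>t. exposes (\<tau> i t) A)"

definition search_cost ::
  "point set \<Rightarrow> nat set \<Rightarrow> (nat \<Rightarrow> real) \<Rightarrow> (nat \<Rightarrow> real \<Rightarrow> point) \<Rightarrow> ennreal" where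
  "search_cost D B c \<tau> =
     (SUP A\<in>D. ennreal (1 / norm A) * (MIN i\<in>B. exposure_time (c i) (\<tau> i) A))"

definition msp_admits :: "point set \<Rightarrow> nat \<Rightarrow> (nat \<Rightarrow> real) \<Rightarrow> ennreal \<Rightarrow> bool" where
  "msp_admits D n c S \<longleftrightarrow>
     (\<exists>\<tau>. msp_feasible D {..<n} \<tau> \<and> search_cost D {..<n} c \<tau> = S)"

text \<open>A solution of the \<open>n\<close>-agent problem in which the agents in \<open>B\<close> alone already expose every
  target and attain the cost.\<close>

definition msp_admits_using ::
  "point set \<Rightarrow> nat \<Rightarrow> (nat \<Rightarrow> real) \<Rightarrow> nat set \<Rightarrow> ennreal \<Rightarrow> bool" where
  "msp_admits_using D n c B S \<longleftrightarrow>
     B \<subseteq> {..<n} \<and>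
     (\<exists>\<tau>. msp_feasible D {..<n} \<tau> \<and> search_cost D {..<n} c \<tau> = S \<and>
          msp_feasible D B \<tau> \<and> search_cost D B c \<tau> = S)"

definition kappa :: "nat \<Rightarrow> real" where
  "kappa i = (THE k. 0 < k \<and> k ^ 3 + k = real i / (2 * pi))"

definition bound_U :: "nat \<Rightarrow> ennreal" where
  "bound_U i =
     (if i = 0 then \<infinity>
      else ennreal (sqrt (1 + (kappa i)\<^sup>2) / kappa i * exp (2 * pi * kappa i / real i)))"

text \<open>For \<open>l = 0\<close> the value is \<open>1 powr (1 / 0) = 1\<close>, the intended convention.\<close>

definition geo_mean :: "(nat \<Rightarrow> real) \<Rightarrow> nat \<Rightarrow> real" where
  "geo_mean c l = (\<Prod>i<l. c i) powr (1 / real l)"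

text \<open>Since \<open>x / \<infinity> = 0\<close> for finite \<open>x\<close> in \<^typ>\<open>ennreal\<close>, the condition holds for \<open>l = 0\<close>.\<close>

definition last_agent :: "nat \<Rightarrow> (nat \<Rightarrow> real) \<Rightarrow> nat" where
  "last_agent n c =
     Max {l\<in>{..<n}.
       ennreal (c l) \<ge> (bound_U (l + 1) / bound_U l) ^ (l + 1) * ennreal (geo_mean c l)}"

lemma kappa_unique:
  assumes "0 < i"
  shows "\<exists>!k. 0 < k \<and> k ^ 3 + k = real i / (2 * pi)"
proof -
  let ?a = "real i / (2 * pi)"
  have a: "?a > 0" using assms by simp
  have "\<exists>k\<ge>0. k \<le> ?a \<and> k ^ 3 + k = ?a"
    by (rule IVT') (use a in \<open>auto intro!: continuous_intros\<close>)
  then obtain k where k: "k \<ge> 0" "k ^ 3 + k = ?a" by blast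
  show ?thesis
  proof (rule ex1I[of _ k])
    show "0 < k \<and> k ^ 3 + k = ?a"
      using k a by (cases "k = 0") auto
  next
    fix x assume x: "0 < x \<and> x ^ 3 + x = ?a"
    show "x = k"
    proof (rule linorder_cases[of x k])
      assume "x < k"
      then have "x ^ 3 < k ^ 3" using x by (intro power_strict_mono) auto
      then show ?thesis using k x \<open>x < k\<close> by linarith
    next
      assume "k < x"
      then have "k ^ 3 < x ^ 3" using k by (intro power_strict_mono) auto
      then show ?thesis using k x \<open>k < x\<close> by linarith
    qed
  qed
qed

lemma geo_mean_0 [simp]: "geo_mean c 0 = 1"
  by (simp add: geo_mean_def)

lemma last_agent_condition_0:
  "ennreal (c 0) \<ge> (bound_U (0 + 1) / bound_U 0) ^ (0 + 1) * ennreal (geo_mean c 0)"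
  by (simp add: bound_U_def)

end

theory Submission
  imports Defs "HOL-Real_Asymp.Real_Asymp"
begin

text \<open>Let \<open>m\<close> minimise \<open>U\<^sub>i / G\<^sub>i\<close>. Agents \<open>0, \<dots>, m - 1\<close> follow logarithmic spirals of common slope
  \<open>k = \<kappa>\<^sub>m\<close>, rotated against each other so that along every ray their visits interleave with
  ratios \<open>\<mu> c\<^sub>j\<close>; one full turn forces \<open>\<mu> = exp (2 \<pi> k / m) / G\<^sub>m\<close>, and the cost is
  \<open>\<mu> sqrt (1 + k\<^sup>2) / k = U\<^sub>m / G\<^sub>m\<close>. All other agents rest at the origin. The visits really occur in
  this order if all \<open>\<mu> c\<^sub>j \<ge> 1\<close>. This follows from \<open>U\<^sub>m / G\<^sub>m \<le> U\<^sub>l / G\<^sub>l\<close> with \<open>l = m - 1\<close>, an inequality that is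
  also equivalent to the defining condition of \<^const>\<open>last_agent\<close> at \<open>l\<close>, whence \<open>l \<le> last_agent n c\<close>.
  The sequence \<open>U\<^sub>i / G\<^sub>i\<close> need not be unimodal, so \<open>l\<close> may be strictly smaller than \<open>last_agent n c\<close>.\<close>

section \<open>Polar coordinates and logarithmic spirals\<close>

definition spiral :: "real \<Rightarrow> real \<Rightarrow> real \<Rightarrow> point" where
  "spiral k p t = polar (exp (k * t + p)) t"

lemma norm_polar [simp]: "norm (polar \<rho> \<psi>) = \<bar>\<rho>\<bar>"
proof -
  have "norm (cos \<psi>, sin \<psi>) = 1"
    by (simp add: norm_Pair)
  then show ?thesis
    by (simp add: polar_def del: scaleR_Pair)
qed

lemma norm_spiral [simp]: "norm (spiral k p t) = exp (k * t + p)"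
  by (simp add: spiral_def)

lemma exposes_imp_norm_le: "exposes P A \<Longrightarrow> norm A \<le> norm P"
  by (auto simp: exposes_def)

lemma not_exposes_origin: "\<not> exposes (0, 0) A"
proof
  assume "exposes (0, 0) A"
  then obtain x \<psi> where "0 < x" "(0, 0) = polar x \<psi>"
    by (auto simp: exposes_def)
  then have "norm ((0, 0) :: point) = x"
    by simp
  with \<open>0 < x\<close> show False by (simp add: zero_prod_def [symmetric])
qed

lemma polar_shift: "polar \<rho> (\<psi> + 2 * pi * of_int z) = polar \<rho> \<psi>"
proof -
  have "sin (pi * (real_of_int z * 2)) = 0" "cos (pi * (real_of_int z * 2)) = 1"
    using sin_int_2pin [of z] cos_int_2pin [of z] by (simp_all add: mult_ac)
  then show ?thesis
    by (simp add: polar_def sin_add cos_add mult_ac)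
qed

lemma exists_polar:
  assumes "A \<noteq> (0, 0)"
  obtains \<psi> where "A = polar (norm A) \<psi>"
proof -
  obtain x y where A: "A = (x, y)" by (cases A)
  let ?r = "norm A"
  have r: "?r > 0" using assms by (simp add: zero_prod_def)
  have "?r\<^sup>2 = x\<^sup>2 + y\<^sup>2" by (simp add: A norm_Pair)
  then have "(x / ?r)\<^sup>2 + (y / ?r)\<^sup>2 = ?r\<^sup>2 / ?r\<^sup>2"
    by (simp only: power_divide add_divide_distrib)
  also have "\<dots> = 1" using r by simp
  finally have "(x / ?r)\<^sup>2 + (y / ?r)\<^sup>2 = 1" .
  then obtain t where "x / ?r = cos t" "y / ?r = sin t"
    by (rule sincos_total_2pi)
  then have "A = polar ?r t"
    using r by (auto simp: A polar_def field_simps)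
  then show ?thesis by (rule that)
qed

text \<open>The parameter of \<open>spiral\<close> is its polar angle, so at an angle of
  \<open>A\<close> the spiral is on the ray of \<open>A\<close> and only the radii remain to be
  compared.\<close>

lemma exposes_spiral_iff_norm:
  assumes "0 < y" "A = polar y t"
  shows "exposes (spiral k p t) A \<longleftrightarrow> y \<le> exp (k * t + p)"
proof
  assume "exposes (spiral k p t) A"
  then show "y \<le> exp (k * t + p)"
    using exposes_imp_norm_le [of "spiral k p t" A] assms by simp
next
  assume "y \<le> exp (k * t + p)"
  then show "exposes (spiral k p t) A"
    using assms unfolding exposes_def spiral_def by (metis exp_gt_zero)
qed

text \<open>The lower bound on the cost tests only targets on the positive horizontal axis, which
  the spirals meet exactly at multiples of a full turn.\<close>

lemma exposes_spiral_axisD: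
  assumes "exposes (spiral k p t) (polar y 0)" "0 < y"
  obtains z :: int where "t = 2 * pi * z" "y \<le> exp (k * t + p)"
proof -
  from assms(1) obtain x y' \<psi> where *: "0 < x" "0 < y'" "spiral k p t = polar x \<psi>"
    "polar y 0 = polar y' \<psi>" "y' \<le> x"
    by (auto simp: exposes_def)
  have "y' = y" using arg_cong [OF *(4), of norm] *(2) assms(2) by simp
  then have "cos \<psi> = 1" using *(2,4) by (simp add: polar_def)
  have x: "x = exp (k * t + p)"
    using arg_cong [OF *(3), of norm] *(1) by simp
  have "cos t = cos \<psi>" using *(3) by (simp add: polar_def spiral_def x)
  then obtain z :: int where "t = z * 2 * pi"
    using \<open>cos \<psi> = 1\<close> cos_one_2pi_int by auto
  with that [of z] x \<open>y' = y\<close> *(5) show ?thesis by simp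
qed

lemma spiral_has_vector_derivative:
  "(spiral k p has_vector_derivative
     (exp (k * t + p) * (k * cos t - sin t), exp (k * t + p) * (k * sin t + cos t))) (at t)"
proof -
  have "spiral k p = (\<lambda>t. (exp (k * t + p) * cos t, exp (k * t + p) * sin t))"
    by (simp add: spiral_def polar_def fun_eq_iff)
  then show ?thesis
    by (auto intro!: has_vector_derivative_Pair derivative_eq_intros
        simp: has_real_derivative_iff_has_vector_derivative [symmetric] algebra_simps)
qed

lemma trajectory_spiral:
  assumes "k > 0"
  shows "trajectory (spiral k p)"
  unfolding trajectory_def
proof (intro conjI allI)
  have "spiral k p differentiable (at t within S)" for t S
    by (rule differentiable_at_withinI) (rule differentiableI_vector [OF spiral_has_vector_derivative])
  then show "spiral k p piecewise_differentiable_on {a..b}" for a b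
    by (rule differentiable_imp_piecewise_differentiable)
  have "filterlim (\<lambda>t. k * t + p) at_bot at_bot"
    unfolding filterlim_at_bot_mirror using assms by real_asymp
  then have "((\<lambda>t. exp (k * t + p)) \<longlongrightarrow> 0) at_bot"
    by (rule filterlim_compose [OF exp_at_bot])
  then have "((\<lambda>t. norm (spiral k p t)) \<longlongrightarrow> 0) at_bot"
    by simp
  then show "(spiral k p \<longlongrightarrow> (0, 0)) at_bot"
    unfolding zero_prod_def [symmetric] by (rule tendsto_norm_zero_cancel)
qed

lemma trajectory_origin: "trajectory (\<lambda>_. (0, 0))"
  unfolding trajectory_def
  by (intro conjI allI differentiable_imp_piecewise_differentiable differentiable_const tendsto_const)

section \<open>Arc length and exposure times of a spiral\<close>

lemma norm_spiral_derivative: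
  "norm (vector_derivative (spiral k p) (at t)) = sqrt (1 + k\<^sup>2) * exp (k * t + p)"
proof -
  have "(k * cos t - sin t)\<^sup>2 + (k * sin t + cos t)\<^sup>2 = (1 + k\<^sup>2) * ((sin t)\<^sup>2 + (cos t)\<^sup>2)"
    by algebra
  then have "(exp (k * t + p) * (k * cos t - sin t))\<^sup>2 + (exp (k * t + p) * (k * sin t + cos t))\<^sup>2
      = (exp (k * t + p))\<^sup>2 * (1 + k\<^sup>2)"
    by (simp only: power_mult_distrib distrib_left [symmetric] sin_cos_squared_add mult_1_right)
  then show ?thesis
    by (simp add: vector_derivative_at [OF spiral_has_vector_derivative] norm_Pair real_sqrt_mult)
qed

lemma traj_length_spiral:
  assumes "k > 0"
  shows "traj_length (spiral k p) t = ennreal (sqrt (1 + k\<^sup>2) / k * exp (k * t + p))"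
proof -
  let ?s = "sqrt (1 + k\<^sup>2)"
  have "traj_length (spiral k p) t =
      (\<integral>\<^sup>+ u. ennreal (?s * exp (k * u + p)) * indicator {..t} u \<partial>lborel)"
    by (simp add: traj_length_def norm_spiral_derivative)
  \<comment> \<open>Reflecting \<open>u\<close> to \<open>- u\<close> turns the integral up to
    \<open>t\<close> into one over a half-line unbounded above, the form
    \<open>nn_integral_FTC_atLeast\<close> handles.\<close>
  also have "\<dots> = (\<integral>\<^sup>+ u. ennreal (?s * exp (k * - u + p)) * indicator {..t} (- u) \<partial>lborel)"
    by (subst nn_integral_real_affine [where c = "-1" and t = 0]) auto
  also have "\<dots> = (\<integral>\<^sup>+ u. ennreal (?s * exp (k * - u + p)) * indicator {- t..} u \<partial>lborel)"
    by (intro nn_integral_cong) (auto split: split_indicator)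
  also have "\<dots> = ennreal (0 - (- (?s / k * exp (k * - (- t) + p))))"
  proof (rule nn_integral_FTC_atLeast)
    have "filterlim (\<lambda>u. - k * u + p) at_bot at_top"
      using assms by real_asymp
    then have "((\<lambda>u. exp (- k * u + p)) \<longlongrightarrow> 0) at_top"
      by (rule filterlim_compose [OF exp_at_bot])
    then have "((\<lambda>u. - (?s / k) * exp (- k * u + p)) \<longlongrightarrow> - (?s / k) * 0) at_top"
      by (intro tendsto_intros)
    then show "((\<lambda>u. - (?s / k * exp (k * - u + p))) \<longlongrightarrow> 0) at_top"
      by simp
  qed (use assms in \<open>auto intro!: derivative_eq_intros simp: field_simps\<close>)
  finally show ?thesis by simp
qed

text \<open>Idle agents get infinite time and so never lower the minimum over agents.\<close>

lemma exposure_time_origin: "exposure_time s (\<lambda>_. (0, 0)) A = \<infinity>"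
  by (simp add: exposure_time_def not_exposes_origin)

lemma exposure_time_spiral_le:
  assumes "k > 0" "s > 0" "A \<noteq> (0, 0)" and expo: "exposes (spiral k p t) A"
  shows "exposure_time s (spiral k p) A \<le> ennreal (sqrt (1 + k\<^sup>2) / k * exp (k * t + p) / s)"
proof -
  let ?T = "{t. exposes (spiral k p t) A}"
  have A: "norm A > 0" using assms by (simp add: zero_prod_def)
  \<comment> \<open>Radii grow with the parameter, so the spiral is too close to the origin to
    expose \<open>A\<close> before this value. The infimum is therefore a genuine lower bound of the
    exposing parameters.\<close>
  have "(ln (norm A) - p) / k \<le> u" if "u \<in> ?T" for u
  proof -
    have "norm A \<le> exp (k * u + p)"
      using exposes_imp_norm_le [of "spiral k p u" A] that by simp
    then have "ln (norm A) \<le> k * u + p"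
      using A by (metis ln_exp ln_mono)
    then show ?thesis using assms by (simp add: field_simps)
  qed
  then have "bdd_below ?T" by (rule bdd_belowI)
  then have "Inf ?T \<le> t" using expo by (intro cInf_lower) auto
  then have "sqrt (1 + k\<^sup>2) / k * exp (k * Inf ?T + p) / s \<le> sqrt (1 + k\<^sup>2) / k * exp (k * t + p) / s"
    using assms by (intro divide_right_mono mult_left_mono) auto
  then show ?thesis
    using expo assms by (auto simp: exposure_time_def traj_length_spiral divide_ennreal)
qed

lemma exposure_time_spiral_ge:
  assumes "k > 0" "s > 0" and lower: "\<And>t. exposes (spiral k p t) A \<Longrightarrow> T \<le> t"
  shows "ennreal (sqrt (1 + k\<^sup>2) / k * exp (k * T + p) / s) \<le> exposure_time s (spiral k p) A"
proof (cases "\<exists>t. exposes (spiral k p t) A")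
  case True
  let ?T = "{t. exposes (spiral k p t) A}"
  have "T \<le> Inf ?T" using True lower by (intro cInf_greatest) auto
  then have "sqrt (1 + k\<^sup>2) / k * exp (k * T + p) / s \<le> sqrt (1 + k\<^sup>2) / k * exp (k * Inf ?T + p) / s"
    using assms by (intro divide_right_mono mult_left_mono) auto
  then show ?thesis
    using True assms by (auto simp: exposure_time_def traj_length_spiral divide_ennreal)
qed (simp add: exposure_time_def)

text \<open>Raising the angle by a full turn lowers \<open>ln (norm A) - k * \<psi>\<close> by
  \<open>2 * pi * k\<close>, so exactly one choice falls in a half-open window of that length.
  Strictness at \<open>0\<close> means that a spiral with phase \<open>0\<close> has not yet reached
  radius \<open>norm A\<close> at angle \<open>\<psi>\<close>.\<close>

lemma exists_polar_window:
  assumes "A \<noteq> (0, 0)" "k > 0"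
  obtains \<psi> where "A = polar (norm A) \<psi>"
    "0 < ln (norm A) - k * \<psi>" "ln (norm A) - k * \<psi> \<le> 2 * pi * k"
proof -
  obtain \<psi> where \<psi>: "A = polar (norm A) \<psi>" using exists_polar assms by blast
  define x where "x = (ln (norm A) - k * \<psi>) / (2 * pi * k)"
  \<comment> \<open>The ceiling minus one, rather than the floor, places \<open>x - z\<close> in the
    interval open at \<open>0\<close> and closed at \<open>1\<close>.\<close>
  define z where "z = \<lceil>x\<rceil> - 1"
  let ?\<psi> = "\<psi> + 2 * pi * of_int z"
  have z: "0 < x - of_int z" "x - of_int z \<le> 1"
    unfolding z_def by linarith+
  have "ln (norm A) - k * \<psi> = x * (2 * pi * k)"
    using assms by (simp add: x_def)
  then have eq: "ln (norm A) - k * ?\<psi> = (x - of_int z) * (2 * pi * k)"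
    by (simp add: algebra_simps)
  show ?thesis
  proof (rule that [of ?\<psi>])
    show "A = polar (norm A) ?\<psi>" using \<psi> by (simp only: polar_shift)
    show "0 < ln (norm A) - k * ?\<psi>"
      unfolding eq using z assms by simp
    show "ln (norm A) - k * ?\<psi> \<le> 2 * pi * k"
      unfolding eq using z assms mult_right_mono [of "x - of_int z" 1 "2 * pi * k"] by simp
  qed
qed

text \<open>On every ray the visited radii, ordered by size, are those of agents \<open>0, 1, \<dots>, m - 1\<close>,
  then again agent \<open>0\<close> one turn later. The step leading to agent \<open>j\<close> multiplies the radius by
  \<open>\<mu> c\<^sub>j\<close>, so a target just beyond the previous visit costs the same whichever agent is next.\<close>

locale interleaved_spirals =
  fixes k \<mu> :: real and m :: nat and c p :: "nat \<Rightarrow> real"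
  assumes k: "0 < k" and m: "0 < m"
    and c_pos: "j < m \<Longrightarrow> 0 < c j"
    and step_ge: "j < m \<Longrightarrow> 1 \<le> \<mu> * c j"
    and p_0: "p 0 = 0"
    and p_Suc: "Suc j < m \<Longrightarrow> p (Suc j) = p j + ln (\<mu> * c (Suc j))"
    and turn: "2 * pi * k = p (m - 1) + ln (\<mu> * c 0)"
begin

definition \<tau> :: "nat \<Rightarrow> real \<Rightarrow> point" where
  "\<tau> i = (if i < m then spiral k (p i) else (\<lambda>_. (0, 0)))"

definition cost :: real where
  "cost = sqrt (1 + k\<^sup>2) / k * \<mu>"

lemma \<mu>_pos: "0 < \<mu>"
  by (rule zero_less_mult_pos2 [OF _ c_pos [OF m]]) (use step_ge [OF m] in linarith)

lemma p_nonneg: "j < m \<Longrightarrow> 0 \<le> p j"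
proof (induction j)
  case (Suc j)
  then have "0 \<le> ln (\<mu> * c (Suc j))" using step_ge by simp
  with Suc p_Suc show ?case by simp
qed (simp add: p_0)

text \<open>The phases increase, and from the last one a further nonnegative step
  \<open>ln (\<mu> * c 0)\<close> completes the turn.\<close>

lemma p_le_turn: "j < m \<Longrightarrow> p j \<le> 2 * pi * k"
proof -
  assume "j < m"
  then have "j \<le> m - 1" by simp
  then have "p j \<le> p (m - 1)"
  proof (induction rule: inc_induct)
    case (step i)
    then have "p i \<le> p (Suc i)" using step_ge [of "Suc i"] p_Suc [of i] by simp
    with step show ?case by simp
  qed simp
  also have "\<dots> \<le> 2 * pi * k" using turn step_ge [OF m] by simp
  finally show ?thesis .
qed

section \<open>Upper bound on the cost\<close>

text \<open>With \<open>q = k * \<psi>\<close>, the radius of agent \<open>Suc j\<close> at angle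
  \<open>\<psi>\<close> is that of agent \<open>j\<close> times \<open>\<mu> * c (Suc j)\<close>.
  Dividing by the speed cancels \<open>c (Suc j)\<close>, so the time depends only on the previous
  radius.\<close>

lemma time_Suc:
  assumes "Suc j < m"
  shows "sqrt (1 + k\<^sup>2) / k * exp (q + p (Suc j)) / c (Suc j) = cost * exp (q + p j)"
  using assms c_pos [of "Suc j"] \<mu>_pos by (simp add: p_Suc cost_def exp_add)

text \<open>The same cancellation where agent \<open>0\<close>, one turn later, follows agent
  \<open>m - 1\<close>.\<close>

lemma time_turn:
  "sqrt (1 + k\<^sup>2) / k * exp (q + 2 * pi * k) / c 0 = cost * exp (q + p (m - 1))"
  unfolding turn using c_pos [OF m] \<mu>_pos by (simp add: cost_def exp_add)

lemma cost_pos: "0 < cost"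
  using k \<mu>_pos by (simp add: cost_def add_pos_nonneg)

text \<open>The agent chosen makes the first visit on the ray at radius at least
  \<open>norm A\<close>. The preceding visit is at a smaller radius, and its radius times
  \<open>cost\<close> is the time of the chosen visit.\<close>

lemma exists_fast_agent:
  assumes "A \<noteq> (0, 0)"
  obtains i t where "i < m" "exposes (\<tau> i t) A"
    "exposure_time (c i) (\<tau> i) A \<le> ennreal (cost * norm A)"
proof -
  have A: "norm A > 0" using assms by (simp add: zero_prod_def)
  obtain \<psi> where \<psi>: "A = polar (norm A) \<psi>"
    "0 < ln (norm A) - k * \<psi>" "ln (norm A) - k * \<psi> \<le> 2 * pi * k"
    using exists_polar_window assms k by blast
  let ?x = "ln (norm A) - k * \<psi>"
  have le: "cost * exp (k * \<psi> + q) \<le> cost * norm A" if "q < ?x" for q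
  proof -
    have "exp (k * \<psi> + q) \<le> exp (ln (norm A))"
      unfolding exp_le_cancel_iff using that by linarith
    then have "exp (k * \<psi> + q) \<le> norm A" using A by (simp only: exp_ln)
    then show ?thesis using cost_pos by (simp only: mult_le_cancel_left_pos)
  qed
  have ge: "norm A \<le> exp (k * \<psi> + q)" if "?x \<le> q" for q
  proof -
    have "exp (ln (norm A)) \<le> exp (k * \<psi> + q)"
      unfolding exp_le_cancel_iff using that by linarith
    then show ?thesis using A by (simp only: exp_ln)
  qed
  show ?thesis
  proof (cases "\<exists>j<m. ?x \<le> p j")
    case True
    define i where "i = (LEAST j. j < m \<and> ?x \<le> p j)"
    have i: "i < m" "?x \<le> p i"
      using LeastI_ex [OF True] by (simp_all add: i_def)
    \<comment> \<open>The window excludes agent \<open>0\<close> at angle \<open>\<psi>\<close>, so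
      the preceding visit belongs to agent \<open>i - 1\<close> at the same angle.\<close>
    have "i \<noteq> 0" using i \<psi>(2) p_0 by (metis not_le)
    then obtain j where j: "i = Suc j" by (cases i) auto
    have "\<not> (j < m \<and> ?x \<le> p j)"
      using not_less_Least [of j "\<lambda>j. j < m \<and> ?x \<le> p j"] j by (simp add: i_def)
    then have pj: "p j < ?x" using i j by auto
    have expo: "exposes (spiral k (p i) \<psi>) A"
      using exposes_spiral_iff_norm [OF A \<psi>(1)] ge i by blast
    have "exposure_time (c i) (spiral k (p i)) A
        \<le> ennreal (sqrt (1 + k\<^sup>2) / k * exp (k * \<psi> + p i) / c i)"
      by (rule exposure_time_spiral_le [OF k c_pos assms expo]) (rule i)
    also have "\<dots> = ennreal (cost * exp (k * \<psi> + p j))"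
      using time_Suc [of j] i unfolding j by simp
    also have "\<dots> \<le> ennreal (cost * norm A)"
      by (intro ennreal_leI le pj)
    finally show ?thesis
      using expo i by (intro that [of i \<psi>]) (simp_all add: \<tau>_def)
  next
    case False
    then have pm: "p (m - 1) < ?x" using m by (simp add: not_le)
    \<comment> \<open>All agents fall short at angle \<open>\<psi>\<close>. The next visit is by
      agent \<open>0\<close> a turn later, and it reaches far enough by the upper end of the
      window.\<close>
    let ?t = "\<psi> + 2 * pi"
    have kt: "k * ?t + p 0 = k * \<psi> + 2 * pi * k" by (simp add: p_0 algebra_simps)
    have "A = polar (norm A) ?t" using \<psi>(1) polar_shift [of "norm A" \<psi> 1] by simp
    then have expo: "exposes (spiral k (p 0) ?t) A"
      using exposes_spiral_iff_norm [OF A] ge [OF \<psi>(3)] unfolding kt [symmetric] by blast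
    have "exposure_time (c 0) (spiral k (p 0)) A
        \<le> ennreal (sqrt (1 + k\<^sup>2) / k * exp (k * ?t + p 0) / c 0)"
      by (rule exposure_time_spiral_le [OF k c_pos [OF m] assms expo])
    also have "\<dots> = ennreal (cost * exp (k * \<psi> + p (m - 1)))"
      unfolding kt time_turn ..
    also have "\<dots> \<le> ennreal (cost * norm A)"
      by (intro ennreal_leI le pm)
    finally show ?thesis
      using expo m by (intro that [of 0 ?t]) (simp_all add: \<tau>_def)
  qed
qed

lemma feasible:
  assumes "{..<m} \<subseteq> B"
  shows "msp_feasible punctured_plane B \<tau>"
  unfolding msp_feasible_def
proof (intro conjI ballI)
  show "trajectory (\<tau> i)" for i
    using trajectory_spiral [OF k] trajectory_origin by (simp add: \<tau>_def)
  fix A assume "A \<in> punctured_plane"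
  then have "A \<noteq> (0, 0)" by (simp add: punctured_plane_def)
  then obtain i t where "i < m" "exposes (\<tau> i t) A"
    by (rule exists_fast_agent)
  then show "\<exists>i\<in>B. \<exists>t. exposes (\<tau> i t) A" using assms by auto
qed

section \<open>Lower bound on the cost\<close>

text \<open>Agent \<open>0\<close> passes the axis at radius \<open>1\<close> with parameter
  \<open>0\<close>, just short of the target, so it must make another turn. The other agents can
  succeed at parameter \<open>0\<close> at the earliest. The time identities then give
  \<open>cost\<close> times the exponential of a nonnegative phase.\<close>

lemma exposure_time_ge_cost:
  assumes y: "1 < y"
  shows "ennreal cost \<le> exposure_time (c i) (\<tau> i) (polar y 0)"
proof (cases "i < m")
  case i: True
  have visit: "\<exists>z::int. t = 2 * pi * z \<and> 0 < p i + 2 * pi * k * z"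
    if expo: "exposes (spiral k (p i) t) (polar y 0)" for t
  proof -
    obtain z :: int where z: "t = 2 * pi * z" "y \<le> exp (k * t + p i)"
      using exposes_spiral_axisD [OF expo] y by auto
    then have "1 < exp (k * t + p i)" using y by linarith
    then have "0 < k * t + p i" by simp
    with z(1) show ?thesis by (auto simp: algebra_simps)
  qed
  show ?thesis
  proof (cases i)
    case 0
    have "2 * pi \<le> t" if expo: "exposes (spiral k (p i) t) (polar y 0)" for t
    proof -
      obtain z :: int where "t = 2 * pi * z" "0 < p i + 2 * pi * k * z"
        using visit [OF expo] by blast
      moreover from this have "0 < (2 * pi * k) * real_of_int z" using 0 p_0 by simp
      then have "0 < z" using zero_less_mult_pos [of "2 * pi * k" "real_of_int z"] k by simp
      ultimately show ?thesis by simp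
    qed
    then have "ennreal (sqrt (1 + k\<^sup>2) / k * exp (k * (2 * pi) + p i) / c i)
        \<le> exposure_time (c i) (spiral k (p i)) (polar y 0)"
      by (intro exposure_time_spiral_ge k c_pos i)
    moreover have "sqrt (1 + k\<^sup>2) / k * exp (k * (2 * pi) + p i) / c i = cost * exp (p (m - 1))"
      using time_turn [of 0] 0 p_0 by (simp add: mult_ac)
    moreover have "cost \<le> cost * exp (p (m - 1))"
      using cost_pos p_nonneg [of "m - 1"] m by simp
    ultimately show ?thesis
      using i by (simp add: \<tau>_def) (metis ennreal_leI order_trans)
  next
    case (Suc j)
    have "0 \<le> t" if expo: "exposes (spiral k (p i) t) (polar y 0)" for t
    proof -
      obtain z :: int where z: "t = 2 * pi * z" "0 < p i + 2 * pi * k * z"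
        using visit [OF expo] by blast
      \<comment> \<open>A phase is at most one full turn, so \<open>z\<close> exceeds
        \<open>-1\<close>.\<close>
      have "0 < 2 * pi * k + 2 * pi * k * z" using z(2) p_le_turn [OF i] by simp
      then have "0 < 2 * pi * k * (1 + z)" by (simp add: algebra_simps)
      then have "0 < real_of_int (1 + z)"
        by (rule zero_less_mult_pos) (use k in simp)
      then have "0 \<le> z" by linarith
      then show ?thesis using z(1) by simp
    qed
    then have "ennreal (sqrt (1 + k\<^sup>2) / k * exp (k * 0 + p i) / c i)
        \<le> exposure_time (c i) (spiral k (p i)) (polar y 0)"
      by (intro exposure_time_spiral_ge k c_pos i)
    moreover have "sqrt (1 + k\<^sup>2) / k * exp (k * 0 + p i) / c i = cost * exp (p j)"
      using time_Suc [of j 0] i Suc by simp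
    moreover have "cost \<le> cost * exp (p j)"
      using cost_pos p_nonneg [of j] i Suc by simp
    ultimately show ?thesis
      using i by (simp add: \<tau>_def) (metis ennreal_leI order_trans)
  qed
qed (simp add: \<tau>_def exposure_time_origin)

text \<open>The ratio for a target at distance \<open>y > 1\<close> on the axis is at least
  \<open>cost / y\<close>; letting \<open>y\<close> decrease to \<open>1\<close> gives the supremum
  without an attaining target. A general \<open>B\<close> covers both agent sets of the theorem at
  once.\<close>

lemma search_cost:
  assumes B: "{..<m} \<subseteq> B" "finite B"
  shows "search_cost punctured_plane B c \<tau> = ennreal cost"
proof (rule antisym)
  have "B \<noteq> {}" using m B by auto
  show "search_cost punctured_plane B c \<tau> \<le> ennreal cost"
    unfolding search_cost_def
  proof (rule SUP_least)
    fix A assume "A \<in> punctured_plane"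
    then have A: "A \<noteq> (0, 0)" by (simp add: punctured_plane_def)
    then have nz: "norm A > 0" by (simp add: zero_prod_def)
    obtain i where i: "i < m" "exposure_time (c i) (\<tau> i) A \<le> ennreal (cost * norm A)"
      using exists_fast_agent [OF A] by blast
    have "(MIN i\<in>B. exposure_time (c i) (\<tau> i) A) \<le> exposure_time (c i) (\<tau> i) A"
      using i B by (intro Min_le) auto
    also note i(2)
    finally have "ennreal (1 / norm A) * (MIN i\<in>B. exposure_time (c i) (\<tau> i) A)
        \<le> ennreal (1 / norm A) * ennreal (cost * norm A)"
      by (rule mult_left_mono) simp
    also have "\<dots> = ennreal cost"
      using nz cost_pos by (simp add: ennreal_mult' [symmetric])
    finally show "ennreal (1 / norm A) * (MIN i\<in>B. exposure_time (c i) (\<tau> i) A) \<le> ennreal cost" .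
  qed
  have approx: "ennreal (cost / y) \<le> search_cost punctured_plane B c \<tau>" if "1 < y" for y
  proof -
    let ?A = "polar y 0"
    have "norm ?A = y" using that by simp
    then have "?A \<noteq> 0" using that by (metis norm_zero not_one_less_zero)
    then have "?A \<in> punctured_plane"
      by (simp add: punctured_plane_def zero_prod_def)
    have "ennreal cost \<le> (MIN i\<in>B. exposure_time (c i) (\<tau> i) ?A)"
      using B \<open>B \<noteq> {}\<close> exposure_time_ge_cost [OF that] by (intro Min.boundedI) auto
    then have "ennreal (1 / y) * ennreal cost
        \<le> ennreal (1 / norm ?A) * (MIN i\<in>B. exposure_time (c i) (\<tau> i) ?A)"
      unfolding \<open>norm ?A = y\<close> by (rule mult_left_mono) simp
    also have "\<dots> \<le> search_cost punctured_plane B c \<tau>"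
      unfolding search_cost_def by (rule SUP_upper) fact
    finally show ?thesis
      using that cost_pos by (simp add: ennreal_mult' [symmetric])
  qed
  have "((\<lambda>y. ennreal (cost / y)) \<longlongrightarrow> ennreal (cost / 1)) (at_right 1)"
    by (intro tendsto_intros) auto
  then have "ennreal (cost / 1) \<le> search_cost punctured_plane B c \<tau>"
    by (rule tendsto_upperbound) (auto simp: eventually_at_filter approx)
  then show "ennreal cost \<le> search_cost punctured_plane B c \<tau>" by simp
qed

end

section \<open>The optimal slope\<close>

text \<open>This is the cost of \<open>i\<close> interleaved spirals of slope \<open>k\<close> at
  unit speed; \<open>bound_U i\<close> is its value at \<open>kappa i\<close>.\<close>

definition spiral_cost :: "nat \<Rightarrow> real \<Rightarrow> real" where
  "spiral_cost i k = sqrt (1 + k\<^sup>2) / k * exp (2 * pi * k / real i)"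

lemma kappa:
  assumes "0 < i"
  shows "0 < kappa i" "kappa i ^ 3 + kappa i = real i / (2 * pi)"
  using theI' [OF kappa_unique [OF assms]] by (auto simp: kappa_def)

lemma bound_U_eq: "0 < i \<Longrightarrow> bound_U i = ennreal (spiral_cost i (kappa i))"
  by (simp add: bound_U_def spiral_cost_def)

lemma spiral_cost_pos: "0 < k \<Longrightarrow> 0 < spiral_cost i k"
  by (simp add: spiral_cost_def add_pos_nonneg)

lemma ln_spiral_cost:
  assumes "0 < k"
  shows "ln (spiral_cost i k) = ln (1 + k\<^sup>2) / 2 - ln k + 2 * pi * k / real i"
proof -
  have "0 < 1 + k\<^sup>2" by (simp add: add_pos_nonneg)
  then show ?thesis
    using assms by (simp add: spiral_cost_def ln_mult ln_div ln_sqrt)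
qed

text \<open>The logarithm of the cost has derivative \<open>2 * pi / i - 1 / (x ^ 3 + x)\<close>.
  The cubic defining \<open>kappa i\<close> says that this vanishes, and by monotonicity of
  \<open>x ^ 3 + x\<close> the sign changes there from negative to positive.\<close>

lemma spiral_cost_kappa_le:
  assumes i: "0 < i" and x: "0 < x"
  shows "spiral_cost i (kappa i) \<le> spiral_cost i x"
proof -
  define k where "k = kappa i"
  have k: "0 < k" "k ^ 3 + k = real i / (2 * pi)"
    using kappa [OF i] by (simp_all add: k_def)
  define h where "h x = ln (1 + x\<^sup>2) / 2 - ln x + 2 * pi * x / real i" for x
  have pos: "0 < x ^ 3 + x" if "0 < x" for x :: real using that by (simp add: add_pos_pos)
  have anti: "1 / (z ^ 3 + z) \<le> 1 / (y ^ 3 + y)" if "0 < y" "y \<le> z" for y z :: real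
    using that pos by (intro divide_left_mono add_mono power_mono mult_pos_pos) auto
  \<comment> \<open>The constant \<open>2 * pi / i\<close> is rewritten through the cubic equation
    for \<open>k\<close>, so that \<open>anti\<close> decides the sign.\<close>
  have dh: "(h has_real_derivative (1 / (k ^ 3 + k) - 1 / (x ^ 3 + x))) (at x)" if "0 < x" for x
  proof -
    have "0 < 1 + x\<^sup>2" by (simp add: add_pos_nonneg)
    then have "1 / (1 + x\<^sup>2) * (2 * x) / 2 - 1 / x = - (1 / (x ^ 3 + x))"
      using that pos [OF that] by (simp add: divide_simps) (simp add: power2_eq_square power3_eq_cube algebra_simps)
    moreover have "1 / (k ^ 3 + k) = 2 * pi / real i"
      using k by simp
    moreover have "(h has_real_derivative (1 / (1 + x\<^sup>2) * (2 * x) / 2 - 1 / x + 2 * pi / real i)) (at x)"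
      unfolding h_def using that \<open>0 < 1 + x\<^sup>2\<close> i
      by (auto intro!: derivative_eq_intros simp: divide_simps) (simp add: algebra_simps)
    ultimately show ?thesis by simp
  qed
  have "h k \<le> h x"
  proof (cases "k \<le> x")
    case True
    then show ?thesis
    proof (rule DERIV_nonneg_imp_nondecreasing)
      fix u assume "k \<le> u" "u \<le> x"
      then show "\<exists>y. (h has_real_derivative y) (at u) \<and> 0 \<le> y"
        using dh [of u] k(1) anti [of k u]
        by (intro exI [of _ "1 / (k ^ 3 + k) - 1 / (u ^ 3 + u)"]) simp
    qed
  next
    case False
    then have "x \<le> k" by simp
    then show ?thesis
    proof (rule DERIV_nonpos_imp_nonincreasing)
      fix u assume "x \<le> u" "u \<le> k"
      then show "\<exists>y. (h has_real_derivative y) (at u) \<and> y \<le> 0"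
        using dh [of u] x anti [of u k]
        by (intro exI [of _ "1 / (k ^ 3 + k) - 1 / (u ^ 3 + u)"]) simp
    qed
  qed
  then have "ln (spiral_cost i k) \<le> ln (spiral_cost i x)"
    using x k by (simp add: ln_spiral_cost h_def)
  then show ?thesis
    using spiral_cost_pos x k by (simp add: k_def [symmetric])
qed

section \<open>Geometric means and consecutive numbers of agents\<close>

lemma geo_mean_pos:
  assumes "\<And>i. i < l \<Longrightarrow> 0 < c i"
  shows "0 < geo_mean c l"
proof -
  have "0 < (\<Prod>i<l. c i)" using assms by (intro prod_pos) auto
  then show ?thesis
    unfolding geo_mean_def powr_gt_zero by (metis less_irrefl)
qed

lemma ln_geo_mean:
  assumes "\<And>i. i < l \<Longrightarrow> 0 < c i"
  shows "ln (geo_mean c l) = (\<Sum>i<l. ln (c i)) / real l"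
proof -
  have "0 < (\<Prod>i<l. c i)" using assms by (intro prod_pos) auto
  moreover have "c i \<noteq> 0" if "i < l" for i
    using assms [OF that] by simp
  then have "ln (\<Prod>i<l. c i) = (\<Sum>i<l. ln (c i))"
    by (intro ln_prod) auto
  ultimately show ?thesis by (simp add: geo_mean_def)
qed

lemma geo_mean_power:
  assumes "\<And>i. i < l \<Longrightarrow> 0 < c i" "0 < l"
  shows "geo_mean c l ^ l = (\<Prod>i<l. c i)"
proof -
  have "0 < (\<Prod>i<l. c i)" using assms by (intro prod_pos) auto
  then have "geo_mean c l ^ l = geo_mean c l powr real l"
    using assms(1) by (subst powr_realpow) (auto intro: geo_mean_pos)
  with \<open>0 < prod c {..<l}\<close> show ?thesis
    using assms(2) by (simp add: geo_mean_def powr_powr)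
qed

text \<open>Raising the cost inequality to the power \<open>l + 1\<close> turns the geometric means
  into products of speeds, which differ by the factor \<open>c l\<close>; cancelling
  \<open>geo_mean c l ^ l\<close> leaves the condition.\<close>

lemma agent_condition_of_cost_le:
  assumes c: "\<And>i. i \<le> l \<Longrightarrow> 0 < c i" and l: "0 < l"
    and le: "spiral_cost (Suc l) (kappa (Suc l)) / geo_mean c (Suc l)
      \<le> spiral_cost l (kappa l) / geo_mean c l"
  shows "ennreal (c l) \<ge> (bound_U (l + 1) / bound_U l) ^ (l + 1) * ennreal (geo_mean c l)"
proof -
  let ?U = "spiral_cost (Suc l) (kappa (Suc l))" and ?V = "spiral_cost l (kappa l)"
  let ?G = "geo_mean c (Suc l)" and ?H = "geo_mean c l"
  have pos: "0 < ?U" "0 < ?V" "0 < ?G" "0 < ?H"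
    using c l by (auto intro!: spiral_cost_pos kappa geo_mean_pos)
  have "?U / ?V * ?H \<le> ?G" using le pos by (simp add: field_simps)
  then have "(?U / ?V * ?H) ^ Suc l \<le> ?G ^ Suc l"
    using pos by (intro power_mono) auto
  also have "?G ^ Suc l = ?H ^ l * c l"
    using geo_mean_power [of "Suc l" c] geo_mean_power [of l c] c l by simp
  finally have "(?U / ?V) ^ Suc l * ?H ^ Suc l \<le> ?H ^ l * c l"
    by (simp only: power_mult_distrib)
  then have "?H ^ l * ((?U / ?V) ^ Suc l * ?H) \<le> ?H ^ l * c l"
    by (simp add: mult_ac)
  then have "(?U / ?V) ^ Suc l * ?H \<le> c l"
    using pos by (simp only: mult_le_cancel_left_pos zero_less_power)
  moreover have "(bound_U (l + 1) / bound_U l) ^ (l + 1) * ennreal ?H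
      = ennreal ((?U / ?V) ^ Suc l * ?H)"
    using pos l by (simp add: bound_U_eq divide_ennreal ennreal_power ennreal_mult del: power_Suc)
  ultimately show ?thesis by (simp add: ennreal_leI)
qed

text \<open>Minimality of \<^term>\<open>kappa l\<close> is used at the slope \<^term>\<open>kappa (Suc l)\<close>, where both costs have
  the same factor \<open>sqrt (1 + k\<^sup>2) / k\<close>.\<close>

lemma step_ge_one_of_cost_le:
  assumes c: "\<And>i. i \<le> l \<Longrightarrow> 0 < c i" and l: "0 < l"
    and le: "spiral_cost (Suc l) (kappa (Suc l)) / geo_mean c (Suc l)
      \<le> spiral_cost l (kappa l) / geo_mean c l"
  shows "1 \<le> exp (2 * pi * kappa (Suc l) / real (Suc l)) / geo_mean c (Suc l) * c l"
proof -
  define k where "k = kappa (Suc l)"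
  let ?G = "geo_mean c (Suc l)" and ?H = "geo_mean c l"
  define s where "s = (\<Sum>i<l. ln (c i))"
  define a where "a = ln (c l)"
  define X where "X = 2 * pi * k"
  have k: "0 < k" using kappa(1) [of "Suc l"] by (simp add: k_def)
  have pos: "0 < ?G" "0 < ?H" "0 < c l" using c by (auto intro!: geo_mean_pos)
  have "spiral_cost l (kappa l) / ?H \<le> spiral_cost l k / ?H"
    using spiral_cost_kappa_le [OF l k] pos by (simp add: divide_right_mono)
  with le have "spiral_cost (Suc l) k / ?G \<le> spiral_cost l k / ?H"
    unfolding k_def by linarith
  then have "ln (spiral_cost (Suc l) k / ?G) \<le> ln (spiral_cost l k / ?H)"
    using pos spiral_cost_pos [OF k] by simp
  \<comment> \<open>The common factor of the two costs cancels in the logarithms, leaving only the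
    exponents and the geometric means.\<close>
  then have "X / real (Suc l) - (s + a) / real (Suc l) \<le> X / real l - s / real l"
    using pos spiral_cost_pos [OF k, THEN less_imp_neq] k c
    by (simp add: ln_div spiral_cost_pos ln_spiral_cost ln_geo_mean s_def a_def X_def)
  then have "(X - s - a) / real (Suc l) \<le> (X - s) / real l"
    by (simp add: diff_divide_distrib add_divide_distrib)
  then have "real l * (X - s - a) \<le> real (Suc l) * (X - s)"
    using l by (simp add: divide_simps mult_ac)
  \<comment> \<open>The left side is the logarithm of \<open>geo_mean c (Suc l)\<close>; splitting
    the right side gives the logarithm of the claim.\<close>
  then have "(s + a) / real (Suc l) \<le> (X + a * real (Suc l)) / real (Suc l)"
    by (intro divide_right_mono) (simp_all add: algebra_simps)
  then have "(s + a) / real (Suc l) \<le> X / real (Suc l) + a"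
    by (simp add: add_divide_distrib del: of_nat_Suc)
  then have "exp 0 \<le> exp (X / real (Suc l) - ln ?G + ln (c l))"
    using c by (simp add: ln_geo_mean s_def a_def)
  also have "\<dots> = exp (X / real (Suc l)) / ?G * c l"
    using pos by (simp add: exp_add exp_diff)
  finally show ?thesis by (simp add: X_def k_def)
qed

theorem theorem2:
  fixes n :: nat and c :: "nat \<Rightarrow> real"
  assumes "n \<ge> 1"
    and "c 0 = 1"
    and "\<And>i. i < n \<Longrightarrow> c i > 0"
    and "\<And>i j. i \<le> j \<Longrightarrow> j < n \<Longrightarrow> c j \<le> c i"
  shows "msp_admits punctured_plane n c
           (MIN i\<in>{1..n}. bound_U i / ennreal (geo_mean c i)) \<and>
         msp_admits_using punctured_plane n c {0..last_agent n c}
           (MIN i\<in>{1..n}. bound_U i / ennreal (geo_mean c i))"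
proof -
  define F where "F i = spiral_cost i (kappa i) / geo_mean c i" for i
  let ?S = "MIN i\<in>{1..n}. bound_U i / ennreal (geo_mean c i)"
  have F: "bound_U i / ennreal (geo_mean c i) = ennreal (F i)" if "i \<in> {1..n}" for i
    using that assms(3) spiral_cost_pos [OF kappa(1), of i i] geo_mean_pos [of i c]
    by (simp add: bound_U_eq F_def divide_ennreal)
  have "?S \<in> (\<lambda>i. bound_U i / ennreal (geo_mean c i)) ` {1..n}"
    using assms(1) by (intro Min_in) auto
  then obtain m where m: "m \<in> {1..n}" and S: "?S = ennreal (F m)"
    using F by auto
  have F_pos: "0 < F i" if "i \<in> {1..n}" for i
    using that assms(3) unfolding F_def
    by (auto intro!: divide_pos_pos spiral_cost_pos kappa geo_mean_pos)
  have F_min: "F m \<le> F i" if "i \<in> {1..n}" for i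
  proof -
    have "?S \<le> bound_U i / ennreal (geo_mean c i)"
      using that by (intro Min_le) auto
    then show ?thesis
      using F [OF that] S F_pos [OF that] by (simp add: ennreal_le_iff)
  qed
  obtain l where l: "m = Suc l" "l < n" using m by (cases m) auto
  have c_pos: "0 < c i" if "i < m" for i using that m assms(3) by auto
  \<comment> \<open>For \<open>l > 0\<close> this compares \<open>F m\<close> with
    \<open>F l\<close>; for \<open>l = 0\<close> there is no smaller number of agents and the
    convention for \<open>bound_U 0\<close> applies.\<close>
  have "ennreal (c l) \<ge> (bound_U (l + 1) / bound_U l) ^ (l + 1) * ennreal (geo_mean c l)"
  proof (cases "l = 0")
    case True
    then show ?thesis using last_agent_condition_0 by simp
  next
    case False
    then show ?thesis
      using F_min [of l] l assms(3) by (intro agent_condition_of_cost_le) (auto simp: F_def)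
  qed
  then have l_le: "l \<le> last_agent n c"
    unfolding last_agent_def using l by (intro Max_ge) auto
  have "last_agent n c \<in> {l\<in>{..<n}.
      ennreal (c l) \<ge> (bound_U (l + 1) / bound_U l) ^ (l + 1) * ennreal (geo_mean c l)}"
    unfolding last_agent_def
    using last_agent_condition_0 assms(1) by (intro Max_in) (auto intro: exI [of _ 0])
  then have last_less: "last_agent n c < n" by simp
  define \<mu> where "\<mu> = exp (2 * pi * kappa m / real m) / geo_mean c m"
  \<comment> \<open>The factor of agent \<open>0\<close> is absent, since its step only closes the
    turn; hence \<open>p 0 = 0\<close> and the shift to \<open>Suc i\<close>.\<close>
  define p where "p j = (\<Sum>i<j. ln (\<mu> * c (Suc i)))" for j
  have G: "0 < geo_mean c m" using c_pos by (rule geo_mean_pos)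
  then have \<mu>: "0 < \<mu>" by (simp add: \<mu>_def)
  have "1 \<le> \<mu> * c l"
  proof (cases "l = 0")
    case True
    then show ?thesis
      using l assms(2) kappa(1) [of 1] by (simp add: \<mu>_def geo_mean_def)
  next
    case False
    then show ?thesis
      using step_ge_one_of_cost_le [of l c] F_min [of l] l c_pos
      by (auto simp: F_def \<mu>_def)
  qed
  \<comment> \<open>Agent \<open>l\<close> is the slowest one in use, so its step bounds all the
    others.\<close>
  moreover have "\<mu> * c l \<le> \<mu> * c j" if "j < m" for j
    using assms(4) [of j l] that l \<mu> by (intro mult_left_mono) auto
  ultimately have step: "1 \<le> \<mu> * c j" if "j < m" for j
    using that by fastforce
  have "p (m - 1) + ln (\<mu> * c 0) = (\<Sum>j<m. ln (\<mu> * c j))"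
    unfolding p_def l by (subst sum.lessThan_Suc_shift) simp
  also have "\<dots> = (\<Sum>j<m. ln \<mu> + ln (c j))"
    using \<mu> c_pos by (intro sum.cong) (simp_all add: ln_mult_pos)
  also have "\<dots> = real m * ln \<mu> + (\<Sum>j<m. ln (c j))"
    by (simp add: sum.distrib)
  also have "ln \<mu> = 2 * pi * kappa m / real m - (\<Sum>j<m. ln (c j)) / real m"
    using G c_pos by (simp add: \<mu>_def ln_div ln_geo_mean)
  also have "real m * \<dots> + (\<Sum>j<m. ln (c j)) = 2 * pi * kappa m"
    using m by (simp add: right_diff_distrib)
  finally have turn: "2 * pi * kappa m = p (m - 1) + ln (\<mu> * c 0)" ..
  interpret interleaved_spirals "kappa m" \<mu> m c p
    using kappa(1) [of m] l c_pos step turn by unfold_locales (auto simp: p_def)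
  have "cost = F m"
    unfolding cost_def by (simp add: F_def spiral_cost_def \<mu>_def)
  \<comment> \<open>One family of curves serves every finite \<open>B\<close> that contains the
    \<open>m\<close> moving agents.\<close>
  then have "msp_feasible punctured_plane B \<tau> \<and> search_cost punctured_plane B c \<tau> = ?S"
    if "{..<m} \<subseteq> B" "finite B" for B
    using feasible search_cost that S by simp
  moreover have "{..<m} \<subseteq> {..<n}" "{..<m} \<subseteq> {0..last_agent n c}" "{0..last_agent n c} \<subseteq> {..<n}"
    using m l l_le last_less by auto
  ultimately show ?thesis
    unfolding msp_admits_def msp_admits_using_def by (meson finite_atLeastAtMost finite_lessThan)
qed

end
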